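(* Let $a\geq3$ be an odd integer and $S_a$ the self-similar Sierpinski carpet. Let $x^0=(0,0)$, $\alpha\in\mathbb{Q}$ and let $\mathscr{O}(x^0,\alpha)$ be an orbit of the unit-square billiard $\Omega(S_0)$. If $\mathscr{O}(x^0,\alpha)$, as an orbit of $\Omega(S_{a,1})$, avoids the middle peripheral square, then the initial condition $(x^0,\alpha)$ determines an orbit of $\Omega(S_a)$. Specifically, the path traversed by the orbit $\mathscr{O}(x^0,\alpha)$ of $\Omega(S_{a,1})$ is exactly the path traversed by the orbit of $\Omega(S_a)$ determined by $(x^0,\alpha)$.
   Context: **Carpets.** Let $a=2j+1$ with $j$ a positive integer. $S_{a,0}=S_0$ is the unit square $[0,1]^2$. $S_{a,n+1}$ is obtained from $S_{a,n}$ by dividing each of the remaining subsquares of side-length $a^{-n}$ into $a^2$ equal squares of side-length $a^{-(n+1)}$ and removing the open middle one. $S_a=\bigcap_{n\ge0}S_{a,n}$. The boundary of a removed open square is called a peripheral square; in $S_{a,1}$ there is exactly one, the middle peripheral square, of side-length $a^{-1}$. **Billiards.** $\Omega(S_{a,n})$ is the billiard table consisting of the unit square with the peripheral squares of $S_{a,n}$ as obstacles: a point moves at unit speed in straight lines and reflects by the law of reflection off the sides of the unit square and of the peripheral squares. Reflection is defined at the corners of the unit square (interior angle $\pi/2$; the trajectory comes back along the path on which it arrived), while a trajectory hitting a corner of a peripheral square is singular and terminates. An initial condition is written $(x^0,\alpha)$, where $x^0$ is a boundary point and $\alpha=\tan\theta$, with $\theta$ the inward pointing initial direction. **Orbits of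 $\Omega(S_a)$.** A sequence of orbits of the tables $\Omega(S_{a,n})$, $n\ge N$, with compatible initial conditions (in particular, with a common initial condition) is constant if the path traversed is identical for every $n\ge N$. The trivial limit of a constant sequence of such periodic orbits (that is, this common path) constitutes an orbit of $\Omega(S_a)$, namely the orbit determined by the initial condition. *)

theory Defs
  imports "HOL-Analysis.Analysis"
begin

text \<open>An axis-parallel square is given by its lower left corner and its side-length.\<close>

type_synonym square = "(real \<times> real) \<times> real"

definition open_square :: "square \<Rightarrow> (real \<times> real) set" where
  "open_square Q = (case Q of (p, s) \<Rightarrow> box p (p + (s, s)))"

definition closed_square :: "square \<Rightarrow> (real \<times> real) set" where
  "closed_square Q = (case Q of (p, s) \<Rightarrow> cbox p (p + (s, s)))"

definition vertical_sides :: "square \<Rightarrow> (real \<times> real) set" where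
  "vertical_sides Q =
     (case Q of (p, s) \<Rightarrow> {z \<in> closed_square Q. fst z = fst p \<or> fst z = fst p + s})"

definition horizontal_sides :: "square \<Rightarrow> (real \<times> real) set" where
  "horizontal_sides Q =
     (case Q of (p, s) \<Rightarrow> {z \<in> closed_square Q. snd z = snd p \<or> snd z = snd p + s})"

definition corners :: "square \<Rightarrow> (real \<times> real) set" where
  "corners Q = vertical_sides Q \<inter> horizontal_sides Q"

definition unit_square :: square where
  "unit_square = ((0, 0), 1)"

definition subsquares :: "nat \<Rightarrow> square \<Rightarrow> square set" where
  "subsquares a Q =
     (case Q of (p, s) \<Rightarrow>
        {(p + (s * real k / real a, s * real l / real a), s / real a) | k l. k < a \<and> l < a})"

definition middle :: "nat \<Rightarrow> square \<Rightarrow> square" where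
  "middle a Q =
     (case Q of (p, s) \<Rightarrow>
        (p + (s * real (a div 2) / real a, s * real (a div 2) / real a), s / real a))"

text \<open>The subsquares of side-length \<open>1 / a ^ n\<close> that make up the \<open>n\<close>-th approximation.\<close>

primrec remaining :: "nat \<Rightarrow> nat \<Rightarrow> square set" where
  "remaining a 0 = {unit_square}"
| "remaining a (Suc n) = (\<Union>Q\<in>remaining a n. subsquares a Q - {middle a Q})"

primrec approx_carpet :: "nat \<Rightarrow> nat \<Rightarrow> (real \<times> real) set" where
  "approx_carpet a 0 = closed_square unit_square"
| "approx_carpet a (Suc n) =
     approx_carpet a n - (\<Union>Q\<in>remaining a n. open_square (middle a Q))"

text \<open>All squares removed up to the \<open>n\<close>-th approximation, not only those of the last stage.\<close>

definition removed :: "nat \<Rightarrow> nat \<Rightarrow> square set" where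
  "removed a n = (\<Union>k<n. middle a ` remaining a k)"

definition peripheral_square :: "square \<Rightarrow> (real \<times> real) set" where
  "peripheral_square Q = frontier (open_square Q)"

definition walls :: "nat \<Rightarrow> nat \<Rightarrow> (real \<times> real) set" where
  "walls a n = frontier (closed_square unit_square) \<union> (\<Union>Q\<in>removed a n. peripheral_square Q)"

text \<open>
  A state consists of a position on the boundary and an outgoing unit direction.  The infimum
  below is meant for directions that point into the table.  It is then the time of the first
  contact with the boundary, and a contact with a corner of an obstacle that is merely grazed
  counts.
\<close>

type_synonym state = "(real \<times> real) \<times> (real \<times> real)"

definition hit_time :: "nat \<Rightarrow> nat \<Rightarrow> state \<Rightarrow> real" where
  "hit_time a n S = (case S of (x, v) \<Rightarrow> Inf {t. 0 < t \<and> x + t *\<^sub>R v \<in> walls a n})"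

definition hit_point :: "nat \<Rightarrow> nat \<Rightarrow> state \<Rightarrow> real \<times> real" where
  "hit_point a n S = (case S of (x, v) \<Rightarrow> x + hit_time a n S *\<^sub>R v)"

text \<open>
  At a corner of the unit square both components of the direction change sign, that is, the
  trajectory comes back along the path on which it arrived.
\<close>

definition reflect :: "nat \<Rightarrow> nat \<Rightarrow> real \<times> real \<Rightarrow> real \<times> real \<Rightarrow> real \<times> real" where
  "reflect a n y v =
     (if y \<in> (\<Union>Q\<in>insert unit_square (removed a n). vertical_sides Q) then - fst v else fst v,
      if y \<in> (\<Union>Q\<in>insert unit_square (removed a n). horizontal_sides Q) then - snd v else snd v)"

text \<open>The value \<open>None\<close> means that the trajectory has terminated at a corner of an obstacle.\<close>

definition billiard_step :: "nat \<Rightarrow> nat \<Rightarrow> state \<Rightarrow> state option" where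
  "billiard_step a n S =
     (if hit_point a n S \<in> (\<Union>Q\<in>removed a n. corners Q) then None
      else Some (hit_point a n S, reflect a n (hit_point a n S) (snd S)))"

primrec billiard_orbit :: "nat \<Rightarrow> nat \<Rightarrow> state \<Rightarrow> nat \<Rightarrow> state option" where
  "billiard_orbit a n S 0 = Some S"
| "billiard_orbit a n S (Suc k) = Option.bind (billiard_orbit a n S k) (billiard_step a n)"

definition initial_state :: "real \<times> real \<Rightarrow> real \<Rightarrow> state" where
  "initial_state x \<theta> = (x, (cos \<theta>, sin \<theta>))"

definition initial_condition :: "nat \<Rightarrow> nat \<Rightarrow> real \<times> real \<Rightarrow> real \<Rightarrow> bool" where
  "initial_condition a n x \<theta> \<longleftrightarrow>
     x \<in> walls a n \<and>
     (\<exists>e>0. \<forall>t\<in>{0<..<e}. x + t *\<^sub>R (cos \<theta>, sin \<theta>) \<in> interior (approx_carpet a n))"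

text \<open>For an orbit that terminates, the path includes the last segment and its singular endpoint.\<close>

definition billiard_path :: "nat \<Rightarrow> nat \<Rightarrow> real \<times> real \<Rightarrow> real \<Rightarrow> (real \<times> real) set" where
  "billiard_path a n x \<theta> =
     (\<Union>k. case billiard_orbit a n (initial_state x \<theta>) k of
             None \<Rightarrow> {}
           | Some S \<Rightarrow> closed_segment (fst S) (hit_point a n S))"

definition periodic_orbit :: "nat \<Rightarrow> nat \<Rightarrow> real \<times> real \<Rightarrow> real \<Rightarrow> bool" where
  "periodic_orbit a n x \<theta> \<longleftrightarrow>
     (\<exists>k>0. billiard_orbit a n (initial_state x \<theta>) k = Some (initial_state x \<theta>))"

text \<open>
  An orbit of the carpet billiard is the common path \<open>P\<close> of an eventually constant sequence of
  periodic orbits of the approximations that have the same initial condition.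
\<close>

definition carpet_orbit :: "nat \<Rightarrow> real \<times> real \<Rightarrow> real \<Rightarrow> (real \<times> real) set \<Rightarrow> bool" where
  "carpet_orbit a x \<theta> P \<longleftrightarrow>
     (\<exists>N. \<forall>n\<ge>N. initial_condition a n x \<theta> \<and> periodic_orbit a n x \<theta> \<and> billiard_path a n x \<theta> = P)"

definition determines_carpet_orbit :: "nat \<Rightarrow> real \<times> real \<Rightarrow> real \<Rightarrow> bool" where
  "determines_carpet_orbit a x \<theta> \<longleftrightarrow> (\<exists>P. carpet_orbit a x \<theta> P)"

definition carpet_path :: "nat \<Rightarrow> real \<times> real \<Rightarrow> real \<Rightarrow> (real \<times> real) set" where
  "carpet_path a x \<theta> = (THE P. carpet_orbit a x \<theta> P)"

end

theory Submission imports Defs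
begin

text \<open>
  Two observations carry the proof.

  Unfolding: reflecting the unit square in its sides straightens a billiard trajectory.  An orbit
  of the unit square that leaves the origin with direction \<open>v\<close> is therefore the image of the
  half-line \<open>{r v | r \<ge> 0}\<close> under the map \<open>fold2\<close>, which sends each coordinate to its distance
  from the nearest even integer.  Corners of the unit square fit into this picture, since
  there both coordinates fold back at once.

  Self-similarity: multiplication by \<open>a ^ k\<close> maps the half-line into itself, and it is compatible
  with folding, because \<open>zigzag (m * zigzag x) = zigzag (m * x)\<close> for every integer \<open>m\<close>.  On the
  other hand it magnifies a square removed from a cell of side \<open>1 / a ^ k\<close> to the middle of a
  unit cell, which folds onto the middle square, as that square is invariant under the symmetries
  of the unit square.  Hence if the folded half-line met any removed square, at whatever level, it
  would also meet the middle square (lemma \<open>avoids_all_removed\<close>).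

  So an orbit that avoids the middle square avoids all removed squares, and then, for every
  approximation of the carpet, it traverses the same folded half-line (lemma
  \<open>unobstructed_path\<close>).  The rational slope makes the orbit periodic: some positive
  multiple of \<open>v\<close> has even integer coordinates, and there the folded motion is back at the
  origin with its initial direction (lemma \<open>folded_line_periodic\<close>).

  The remaining work is to match the folded half-line with the step-by-step definition of the
  billiard.  The successive states belong to the times at which the half-line crosses the
  integer grid.
\<close>

section \<open>Folding the line onto the unit interval\<close>

text \<open>
  The triangle wave of period 2, that is, the distance from \<open>x\<close> to the nearest even integer.
\<close>

definition zigzag :: "real \<Rightarrow> real" where
  "zigzag x = (if even \<lfloor>x\<rfloor> then x - of_int \<lfloor>x\<rfloor> else of_int \<lfloor>x\<rfloor> + 1 - x)"

text \<open>
  The right-hand derivative of \<open>zigzag\<close>.  It has to be one-sided because at integer points the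
  direction after the reflection is wanted.
\<close>

definition heading :: "real \<Rightarrow> real" where
  "heading x = (if even \<lfloor>x\<rfloor> then 1 else - 1)"

text \<open>
  On a closed unit cell the formula of the left end also holds at the right end, because
  neighbouring pieces agree there.
\<close>

lemma zigzag_between:
  assumes "of_int m \<le> x" "x \<le> of_int m + 1"
  shows "zigzag x = (if even m then x - of_int m else of_int m + 1 - x)"
proof (cases "x < of_int m + 1")
  case True
  then have "\<lfloor>x\<rfloor> = m" using assms by (simp add: floor_eq_iff)
  then show ?thesis by (simp add: zigzag_def)
next
  case False
  then have "x = of_int (m + 1)" using assms by simp
  then show ?thesis by (auto simp: zigzag_def)
qed

lemma zigzag_bounds: "0 \<le> zigzag x" "zigzag x \<le> 1"
  unfolding zigzag_def by (auto; linarith)+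

lemma zigzag_translate_even: "zigzag (x + of_int (2 * i)) = zigzag x"
  unfolding zigzag_def by (simp only: floor_add_int[symmetric]) simp

lemma zigzag_minus: "zigzag (- x) = zigzag x"
proof -
  have "- x \<ge> of_int (- \<lfloor>x\<rfloor> - 1)" "- x \<le> of_int (- \<lfloor>x\<rfloor> - 1) + 1"
    by simp_all linarith
  from zigzag_between[OF this] show ?thesis
    by (auto simp: zigzag_def)
qed

text \<open>
  The folded value is \<open>x\<close> or \<open>- x\<close> up to an even integer, and multiplication by an integer
  preserves this relation.
\<close>

lemma zigzag_mult_zigzag: "zigzag (of_int m * zigzag x) = zigzag (of_int m * x)"
proof (cases "even \<lfloor>x\<rfloor>")
  case True
  then obtain i where i: "\<lfloor>x\<rfloor> = 2 * i" by (rule evenE)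
  have "of_int m * zigzag x = of_int m * x + of_int (2 * (- m * i))"
    using True by (simp add: zigzag_def i algebra_simps)
  then show ?thesis by (simp only: zigzag_translate_even)
next
  case False
  then obtain i where i: "\<lfloor>x\<rfloor> = 2 * i + 1" by (rule oddE)
  have "of_int m * zigzag x = - (of_int m * x) + of_int (2 * (m * (i + 1)))"
    using False by (simp add: zigzag_def i algebra_simps)
  then show ?thesis by (simp only: zigzag_translate_even zigzag_minus)
qed

lemma zigzag_Ints_iff: "zigzag x = 0 \<or> zigzag x = 1 \<longleftrightarrow> x \<in> \<int>"
proof
  assume "zigzag x = 0 \<or> zigzag x = 1"
  then have "x = of_int \<lfloor>x\<rfloor> \<or> x = of_int (\<lfloor>x\<rfloor> + 1)"
    using floor_correct[of x] by (auto simp: zigzag_def split: if_splits)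
  then show "x \<in> \<int>" by (metis Ints_of_int)
next
  assume "x \<in> \<int>"
  then obtain i where "x = of_int i" by (rule Ints_cases)
  then show "zigzag x = 0 \<or> zigzag x = 1" by (simp add: zigzag_def)
qed

text \<open>
  The bound on \<open>y\<close> includes the next integer, so that the affine motion reaches its wall.
\<close>

lemma zigzag_affine:
  assumes "x \<le> y" "y \<le> of_int \<lfloor>x\<rfloor> + 1"
  shows "zigzag y = zigzag x + heading x * (y - x)"
proof -
  have "of_int \<lfloor>x\<rfloor> \<le> y" using assms(1) by linarith
  from zigzag_between[OF this assms(2)] show ?thesis
    by (auto simp: zigzag_def heading_def)
qed

text \<open>
  The law of reflection in one coordinate.
\<close>

lemma heading_flips_iff:
  assumes "x < y" "y \<le> of_int \<lfloor>x\<rfloor> + 1"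
  shows "heading y = (if y \<in> \<int> then - heading x else heading x)"
proof (cases "y = of_int \<lfloor>x\<rfloor> + 1")
  case True
  then have y: "y = of_int (\<lfloor>x\<rfloor> + 1)" by simp
  show ?thesis by (simp only: y Ints_of_int) (simp add: heading_def)
next
  case False
  have "of_int \<lfloor>x\<rfloor> < y" using assms(1) by linarith
  then have f: "\<lfloor>y\<rfloor> = \<lfloor>x\<rfloor>" using assms(2) False by (simp add: floor_eq_iff)
  then have "y \<notin> \<int>" using \<open>of_int \<lfloor>x\<rfloor> < y\<close>
    by (metis Ints_cases floor_of_int less_irrefl)
  then show ?thesis by (simp add: f heading_def)
qed

section \<open>Axis-parallel squares\<close>

lemma mem_closed_square:
  "z \<in> closed_square (p, s) \<longleftrightarrow>
     fst p \<le> fst z \<and> fst z \<le> fst p + s \<and> snd p \<le> snd z \<and> snd z \<le> snd p + s"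
  by (cases p; cases z) (auto simp: closed_square_def cbox_Pair_eq)

lemma mem_open_square:
  "z \<in> open_square (p, s) \<longleftrightarrow>
     fst p < fst z \<and> fst z < fst p + s \<and> snd p < snd z \<and> snd z < snd p + s"
  by (cases p; cases z) (auto simp: open_square_def mem_box Basis_prod_def)

lemma open_square_subset_closed_square: "open_square Q \<subseteq> closed_square Q"
  by (cases Q) (auto simp: mem_closed_square mem_open_square)

lemma closed_closed_square: "closed (closed_square Q)"
  by (cases Q) (simp only: closed_square_def prod.case closed_cbox)

lemma interior_closed_square: "interior (closed_square Q) = open_square Q"
  by (cases Q) (simp only: closed_square_def open_square_def prod.case interior_cbox)

lemma frontier_closed_square: "frontier (closed_square Q) = closed_square Q - open_square Q"
  by (simp add: frontier_def interior_closed_square closed_closed_square)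

lemma peripheral_square_eq:
  assumes "0 < snd Q"
  shows "peripheral_square Q = closed_square Q - open_square Q"
proof -
  obtain p s where Q: "Q = (p, s)" by (cases Q)
  have "p + (s / 2, s / 2) \<in> open_square Q"
    using assms by (simp add: Q mem_open_square)
  then have "box p (p + (s, s)) \<noteq> {}"
    by (auto simp: Q open_square_def)
  then show ?thesis
    by (simp add: Q peripheral_square_def frontier_box open_square_def closed_square_def)
qed

lemma sides_subset_peripheral_square:
  assumes "0 < snd Q"
  shows "vertical_sides Q \<subseteq> peripheral_square Q" "horizontal_sides Q \<subseteq> peripheral_square Q"
  unfolding peripheral_square_eq[OF assms]
  by (cases Q, auto simp: vertical_sides_def mem_open_square)
    (cases Q, auto simp: horizontal_sides_def mem_open_square)

section \<open>The removed squares\<close>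

lemma remaining_grid:
  assumes "Q \<in> remaining a n"
  shows "\<exists>u v. Q = ((real u / real a ^ n, real v / real a ^ n), 1 / real a ^ n)"
  using assms
proof (induction n arbitrary: Q)
  case 0
  then show ?case by (auto simp: unit_square_def intro!: exI[of _ 0])
next
  case (Suc n)
  then obtain R where R: "R \<in> remaining a n" "Q \<in> subsquares a R" by auto
  obtain u v where uv: "R = ((real u / real a ^ n, real v / real a ^ n), 1 / real a ^ n)"
    using Suc.IH[OF R(1)] by blast
  obtain k l where kl: "k < a"
    "Q = ((real u / real a ^ n + 1 / real a ^ n * real k / real a,
           real v / real a ^ n + 1 / real a ^ n * real l / real a), 1 / real a ^ n / real a)"
    using R(2) by (auto simp: subsquares_def uv)
  then have "Q = ((real (u * a + k) / real a ^ Suc n, real (v * a + l) / real a ^ Suc n),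
                  1 / real a ^ Suc n)"
    by (simp add: field_simps)
  then show ?case by blast
qed

lemma finite_remaining: "finite (remaining a n)"
proof (induction n)
  case (Suc n)
  have "finite (subsquares a Q)" for Q
  proof -
    have "subsquares a Q \<subseteq> (\<lambda>(k, l). (fst Q + (snd Q * real k / real a, snd Q * real l / real a),
            snd Q / real a)) ` ({..<a} \<times> {..<a})"
      by (cases Q) (auto simp: subsquares_def image_iff)
    then show ?thesis by (rule finite_subset) simp
  qed
  then show ?case using Suc by simp
qed simp

lemma finite_removed: "finite (removed a n)"
  by (simp add: removed_def finite_remaining)

lemma removed_1: "removed a 1 = {middle a unit_square}"
  by (simp add: removed_def lessThan_Suc)

lemma side_removed_pos:
  assumes "0 < a" "Q \<in> removed a n"
  shows "0 < snd Q"
proof -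
  obtain k R where "R \<in> remaining a k" "Q = middle a R"
    using assms(2) by (auto simp: removed_def)
  then show ?thesis using assms(1) remaining_grid[of R a k] by (auto simp: middle_def)
qed

lemma mem_middle_unit_square:
  assumes "odd a"
  shows "z \<in> closed_square (middle a unit_square) \<longleftrightarrow>
    \<bar>fst z - 1 / 2\<bar> \<le> 1 / (2 * real a) \<and> \<bar>snd z - 1 / 2\<bar> \<le> 1 / (2 * real a)"
proof -
  obtain j where j: "a = 2 * j + 1" using assms by (rule oddE)
  then have "a div 2 = j" "0 < a" by simp_all
  moreover have "real j / real a = 1 / 2 - 1 / (2 * real a)"
    "1 / real a = 2 * (1 / (2 * real a))"
    using j \<open>0 < a\<close> by (simp_all add: field_simps)
  ultimately show ?thesis
    by (simp add: middle_def unit_square_def mem_closed_square abs_le_iff; linarith)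
qed

definition fold2 :: "real \<times> real \<Rightarrow> real \<times> real" where
  "fold2 z = (zigzag (fst z), zigzag (snd z))"

lemma fold2_scale_fold2: "fold2 (real m *\<^sub>R fold2 z) = fold2 (real m *\<^sub>R z)"
  using zigzag_mult_zigzag[of "int m"] by (simp add: fold2_def)

text \<open>
  Folding is a reflection or a translation on each unit cell, so it keeps the distance from the
  midpoint.
\<close>

lemma zigzag_central:
  assumes "\<bar>x - (of_int m + 1 / 2)\<bar> \<le> d" "d \<le> 1 / 2"
  shows "\<bar>zigzag x - 1 / 2\<bar> \<le> d"
proof -
  have "of_int m \<le> x" "x \<le> of_int m + 1" using assms by (auto simp: abs_le_iff)
  from zigzag_between[OF this] show ?thesis using assms(1) by (auto simp: abs_le_iff)
qed

text \<open>
  The centre of the cell \<open>Q\<close> is \<open>(u + 1 / 2, v + 1 / 2) / a ^ k\<close>, and the square removed from it has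
  half-side \<open>1 / (2 * a ^ (k + 1))\<close>.  After magnification by \<open>a ^ k\<close> these become the midpoint of a
  unit cell and the half-side of the middle square.
\<close>

lemma removed_magnified:
  assumes "odd a" "Q \<in> remaining a k" "z \<in> closed_square (middle a Q)"
  shows "fold2 (real (a ^ k) *\<^sub>R z) \<in> closed_square (middle a unit_square)"
proof -
  obtain j where j: "a = 2 * j + 1" using assms(1) by (rule oddE)
  then have a: "a div 2 = j" "0 < a" by simp_all
  have ja: "real j / real a = 1 / 2 - 1 / (2 * real a)" "1 / real a = 2 * (1 / (2 * real a))"
    using j a by (simp_all add: field_simps)
  have near: "\<bar>zigzag (real (a ^ k) * x) - 1 / 2\<bar> \<le> 1 / (2 * real a)"
    if x: "real u / real a ^ k + real j / (real a ^ k * real a) \<le> x"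
      "x \<le> real u / real a ^ k + real j / (real a ^ k * real a) + 1 / (real a ^ k * real a)"
    for x u
  proof -
    have "real u + real j / real a \<le> real (a ^ k) * x"
      "real (a ^ k) * x \<le> real u + real j / real a + 1 / real a"
      using x a by (simp_all add: field_simps)
    then have "\<bar>real (a ^ k) * x - (of_int (int u) + 1 / 2)\<bar> \<le> 1 / (2 * real a)"
      unfolding abs_le_iff of_int_of_nat_eq using ja by linarith
    then show ?thesis by (rule zigzag_central) (use a in simp)
  qed
  obtain u v where "Q = ((real u / real a ^ k, real v / real a ^ k), 1 / real a ^ k)"
    using remaining_grid[OF assms(2)] by blast
  then show ?thesis
    using assms(3) a near[of u "fst z"] near[of v "snd z"]
    unfolding mem_middle_unit_square[OF assms(1)]
    by (simp add: middle_def mem_closed_square fold2_def del: of_nat_power)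
qed

section \<open>The folded line as a billiard trajectory\<close>

text \<open>
  The state of the unobstructed billiard at time \<open>t\<close>, in the sense that the direction is the one
  after a possible reflection at time \<open>t\<close>.
\<close>

definition folded_state :: "real \<times> real \<Rightarrow> real \<Rightarrow> state" where
  "folded_state v t =
     (fold2 (t *\<^sub>R v), (heading (t * fst v) * fst v, heading (t * snd v) * snd v))"

definition next_crossing :: "real \<times> real \<Rightarrow> real \<Rightarrow> real" where
  "next_crossing v t =
     min ((of_int \<lfloor>t * fst v\<rfloor> + 1) / fst v) ((of_int \<lfloor>t * snd v\<rfloor> + 1) / snd v)"

lemma le_next_crossing_iff:
  assumes "0 < fst v" "0 < snd v"
  shows "r \<le> next_crossing v t \<longleftrightarrow>
    r * fst v \<le> of_int \<lfloor>t * fst v\<rfloor> + 1 \<and> r * snd v \<le> of_int \<lfloor>t * snd v\<rfloor> + 1"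
  using assms by (simp add: next_crossing_def pos_le_divide_eq)

lemma less_next_crossing_iff:
  assumes "0 < fst v" "0 < snd v"
  shows "r < next_crossing v t \<longleftrightarrow>
    r * fst v < of_int \<lfloor>t * fst v\<rfloor> + 1 \<and> r * snd v < of_int \<lfloor>t * snd v\<rfloor> + 1"
  using assms by (simp add: next_crossing_def pos_less_divide_eq)

lemma next_crossing_gt:
  assumes "0 < fst v" "0 < snd v"
  shows "t < next_crossing v t"
  using assms by (simp add: less_next_crossing_iff)

text \<open>
  The end of a folded segment lies on a side of the unit square.
\<close>

lemma next_crossing_Ints:
  assumes "0 < fst v" "0 < snd v"
  shows "next_crossing v t * fst v \<in> \<int> \<or> next_crossing v t * snd v \<in> \<int>"
proof -
  have "next_crossing v t * fst v = of_int (\<lfloor>t * fst v\<rfloor> + 1) \<or>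
        next_crossing v t * snd v = of_int (\<lfloor>t * snd v\<rfloor> + 1)"
    using assms by (auto simp: next_crossing_def min_def)
  then show ?thesis by (metis Ints_of_int)
qed

lemma folded_motion:
  assumes "0 < fst v" "0 < snd v" "t \<le> r" "r \<le> next_crossing v t"
  shows "fst (folded_state v t) + (r - t) *\<^sub>R snd (folded_state v t) = fold2 (r *\<^sub>R v)"
proof -
  have "t * fst v \<le> r * fst v" "t * snd v \<le> r * snd v"
    using assms by (simp_all add: mult_right_mono)
  then show ?thesis
    using assms zigzag_affine[of "t * fst v" "r * fst v"] zigzag_affine[of "t * snd v" "r * snd v"]
    by (simp add: le_next_crossing_iff folded_state_def fold2_def algebra_simps)
qed

lemma fold2_wall_iff:
  "fold2 z \<in> frontier (closed_square unit_square) \<longleftrightarrow> fst z \<in> \<int> \<or> snd z \<in> \<int>"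
  unfolding zigzag_Ints_iff[symmetric] using zigzag_bounds[of "fst z"] zigzag_bounds[of "snd z"]
  by (auto simp: frontier_closed_square unit_square_def mem_closed_square mem_open_square
      fold2_def)

lemma fold2_side_iff:
  "fold2 z \<in> vertical_sides unit_square \<longleftrightarrow> fst z \<in> \<int>"
  "fold2 z \<in> horizontal_sides unit_square \<longleftrightarrow> snd z \<in> \<int>"
  unfolding zigzag_Ints_iff[symmetric] using zigzag_bounds[of "fst z"] zigzag_bounds[of "snd z"]
  by (auto simp: vertical_sides_def horizontal_sides_def unit_square_def mem_closed_square
      fold2_def)

lemma not_Ints_between: "x < y \<Longrightarrow> y < of_int \<lfloor>x\<rfloor> + 1 \<Longrightarrow> y \<notin> \<int>" for x y :: real
proof
  assume "x < y" "y < of_int \<lfloor>x\<rfloor> + 1" "y \<in> \<int>"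
  then obtain i where i: "y = of_int i" by (auto elim: Ints_cases)
  have "y < of_int (\<lfloor>x\<rfloor> + 1)" using \<open>y < _\<close> by simp
  then have "i \<le> \<lfloor>x\<rfloor>" unfolding i of_int_less_iff by simp
  then have "of_int i \<le> x" by linarith
  then show False using \<open>x < y\<close> i by simp
qed

lemma folded_between_crossings:
  assumes "0 < fst v" "0 < snd v" "t < r" "r < next_crossing v t"
  shows "r * fst v \<notin> \<int>" "r * snd v \<notin> \<int>"
proof -
  have "t * fst v < r * fst v" "t * snd v < r * snd v"
    using assms by (simp_all only: mult_strict_right_mono)
  moreover have "r * fst v < of_int \<lfloor>t * fst v\<rfloor> + 1" "r * snd v < of_int \<lfloor>t * snd v\<rfloor> + 1"
    using assms less_next_crossing_iff by blast+
  ultimately show "r * fst v \<notin> \<int>" "r * snd v \<notin> \<int>"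
    by (blast dest: not_Ints_between)+
qed

definition obstacles :: "nat \<Rightarrow> nat \<Rightarrow> (real \<times> real) set" where
  "obstacles a n = (\<Union>Q\<in>removed a n. peripheral_square Q)"

lemma walls_eq: "walls a n = frontier (closed_square unit_square) \<union> obstacles a n"
  by (simp add: walls_def obstacles_def)

lemma closed_obstacles: "closed (obstacles a n)"
  by (simp add: obstacles_def closed_UN finite_removed peripheral_square_def)

text \<open>
  The first contact comes at the latest when the folded line reaches the boundary of the unit
  square.  The infimum in \<open>hit_time\<close> is a minimum: the start is not on an obstacle and the
  obstacles are closed, so the contacts with them up to that moment form a compact set of
  positive times.
\<close>

lemma first_contact:
  assumes v: "0 < fst v" "0 < snd v" and free: "fold2 (t *\<^sub>R v) \<notin> obstacles a n"
  obtains m where "t < m"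
    "hit_point a n (folded_state v t) = fold2 (m *\<^sub>R v)"
    "m = next_crossing v t \<or> fold2 (m *\<^sub>R v) \<in> obstacles a n"
proof -
  define x where "x = fst (folded_state v t)"
  define w where "w = snd (folded_state v t)"
  define d where "d = next_crossing v t - t"
  have S: "folded_state v t = (x, w)" by (simp add: x_def w_def)
  have d: "0 < d" using next_crossing_gt[OF v] by (simp add: d_def)
  have motion: "x + s *\<^sub>R w = fold2 ((t + s) *\<^sub>R v)" if "0 \<le> s" "s \<le> d" for s
    using folded_motion[OF v, of t "t + s"] that by (simp add: x_def w_def d_def)
  \<comment> \<open>The contact times up to \<open>d\<close>: before \<open>d\<close> only obstacles can be met.\<close>
  define C where "C = insert d ({0..d} \<inter> (\<lambda>s. x + s *\<^sub>R w) -` obstacles a n)"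
  have "closed ((\<lambda>s. x + s *\<^sub>R w) -` obstacles a n)"
    by (intro continuous_closed_vimage closed_obstacles continuous_intros)
  then have "compact C"
    unfolding C_def by (intro compact_insert compact_Int_closed compact_Icc)
  moreover have "C \<noteq> {}" by (simp add: C_def)
  ultimately obtain s where s: "s \<in> C" "\<And>r. r \<in> C \<Longrightarrow> s \<le> r"
    using compact_attains_inf[of C] by blast
  have "0 \<notin> C" using free motion[of 0] d by (simp add: C_def)
  then have s0: "0 < s" "s \<le> d" using s(1) d by (auto simp: C_def less_le)
  have end_wall: "fold2 ((t + d) *\<^sub>R v) \<in> frontier (closed_square unit_square)"
    using next_crossing_Ints[OF v, of t] by (simp add: fold2_wall_iff d_def)
  have "Inf {r. 0 < r \<and> x + r *\<^sub>R w \<in> walls a n} = s"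
  proof (rule cInf_eq_minimum)
    have "x + s *\<^sub>R w \<in> walls a n"
      using s(1) s0 end_wall motion[of d] d by (auto simp: C_def walls_eq)
    then show "s \<in> {r. 0 < r \<and> x + r *\<^sub>R w \<in> walls a n}" using s0 by simp
  next
    fix r assume "r \<in> {r. 0 < r \<and> x + r *\<^sub>R w \<in> walls a n}"
    then have r: "0 < r" "x + r *\<^sub>R w \<in> walls a n" by auto
    show "s \<le> r"
    proof (cases "r < d")
      case True
      then have "x + r *\<^sub>R w \<notin> frontier (closed_square unit_square)"
        using r folded_between_crossings[OF v, of t "t + r"]
        by (simp add: motion fold2_wall_iff d_def)
      then have "r \<in> C" using r True by (simp add: C_def walls_eq)
      then show ?thesis by (rule s(2))
    qed (use s0 in simp)
  qed
  then have h: "hit_time a n (folded_state v t) = s" by (simp add: S hit_time_def)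
  have "t < t + s" using s0 by simp
  moreover have "hit_point a n (folded_state v t) = fold2 ((t + s) *\<^sub>R v)"
    using h s0 motion[of s] by (simp add: S hit_point_def)
  moreover have "t + s = next_crossing v t \<or> fold2 ((t + s) *\<^sub>R v) \<in> obstacles a n"
    using s(1) s0 motion[of s] by (auto simp: C_def d_def)
  ultimately show ?thesis by (rule that)
qed

text \<open>
  A hit away from the obstacles touches only sides of the unit square, so each component of the
  direction changes its sign exactly when the corresponding coordinate of the unfolded line is an
  integer.  At a corner of the unit square both components do.
\<close>

lemma step_folded_state:
  assumes v: "0 < fst v" "0 < snd v" and a: "0 < a"
    and hit: "hit_point a n (folded_state v t) = fold2 (next_crossing v t *\<^sub>R v)"
    and free: "fold2 (next_crossing v t *\<^sub>R v) \<notin> obstacles a n"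
  shows "billiard_step a n (folded_state v t) = Some (folded_state v (next_crossing v t))"
proof -
  define r where "r = next_crossing v t"
  have sides: "fold2 (r *\<^sub>R v) \<notin> vertical_sides Q" "fold2 (r *\<^sub>R v) \<notin> horizontal_sides Q"
    if "Q \<in> removed a n" for Q
    using that free sides_subset_peripheral_square[OF side_removed_pos[OF a that]]
    by (auto simp: obstacles_def r_def)
  have tr: "t < r" using next_crossing_gt[OF v] by (simp add: r_def)
  have "r * fst v \<le> of_int \<lfloor>t * fst v\<rfloor> + 1" "r * snd v \<le> of_int \<lfloor>t * snd v\<rfloor> + 1"
    using le_next_crossing_iff[OF v, of r t] by (simp_all add: r_def)
  moreover have "t * fst v < r * fst v" "t * snd v < r * snd v"
    using tr v by (simp_all only: mult_strict_right_mono)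
  ultimately have
    "heading (r * fst v) = (if r * fst v \<in> \<int> then - heading (t * fst v) else heading (t * fst v))"
    "heading (r * snd v) = (if r * snd v \<in> \<int> then - heading (t * snd v) else heading (t * snd v))"
    by (simp_all only: heading_flips_iff)
  moreover have
    "fold2 (r *\<^sub>R v) \<in> (\<Union>Q\<in>insert unit_square (removed a n). vertical_sides Q) \<longleftrightarrow> r * fst v \<in> \<int>"
    "fold2 (r *\<^sub>R v) \<in> (\<Union>Q\<in>insert unit_square (removed a n). horizontal_sides Q) \<longleftrightarrow> r * snd v \<in> \<int>"
    using sides fold2_side_iff[of "r *\<^sub>R v"] by auto
  ultimately have "reflect a n (fold2 (r *\<^sub>R v)) (snd (folded_state v t)) = snd (folded_state v r)"
    by (simp only: reflect_def folded_state_def snd_conv fst_conv) simp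
  moreover have "fold2 (r *\<^sub>R v) \<notin> (\<Union>Q\<in>removed a n. corners Q)"
    using sides by (auto simp: corners_def)
  moreover have "fst (folded_state v r) = fold2 (r *\<^sub>R v)" by (simp add: folded_state_def)
  ultimately show ?thesis
    using hit unfolding billiard_step_def r_def[symmetric] by (metis prod.collapse)
qed

section \<open>Crossing times\<close>

definition crossing :: "real \<times> real \<Rightarrow> nat \<Rightarrow> real" where
  "crossing v k = (next_crossing v ^^ k) 0"

lemma crossing_0: "crossing v 0 = 0"
  and crossing_Suc: "crossing v (Suc k) = next_crossing v (crossing v k)"
  unfolding crossing_def by simp_all

lemma crossing_nonneg:
  assumes "0 < fst v" "0 < snd v"
  shows "0 \<le> crossing v k"
proof (induction k)
  case (Suc k)
  then show ?case
    using next_crossing_gt[OF assms, of "crossing v k"] unfolding crossing_Suc by linarith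
qed (simp add: crossing_0)

lemma crossing_Ints:
  assumes "0 < fst v" "0 < snd v"
  shows "crossing v k * fst v \<in> \<int> \<or> crossing v k * snd v \<in> \<int>"
  using next_crossing_Ints[OF assms] by (cases k) (simp_all add: crossing_0 crossing_Suc)

text \<open>
  At every crossing at least one of the two integer parts grows.  This excludes an accumulation of
  crossing times.
\<close>

lemma crossing_count:
  assumes v: "0 < fst v" "0 < snd v"
  shows "int k \<le> \<lfloor>crossing v k * fst v\<rfloor> + \<lfloor>crossing v k * snd v\<rfloor>"
proof (induction k)
  case (Suc k)
  define t where "t = crossing v k"
  define r where "r = next_crossing v t"
  have "t < r" using next_crossing_gt[OF v] by (simp add: r_def)
  then have "t * fst v \<le> r * fst v" "t * snd v \<le> r * snd v"
    using v by (simp_all add: mult_right_mono)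
  then have mono: "\<lfloor>t * fst v\<rfloor> \<le> \<lfloor>r * fst v\<rfloor>" "\<lfloor>t * snd v\<rfloor> \<le> \<lfloor>r * snd v\<rfloor>"
    by (simp_all add: floor_mono)
  have "\<not> r < next_crossing v t" by (simp add: r_def)
  then have "of_int (\<lfloor>t * fst v\<rfloor> + 1) \<le> r * fst v \<or> of_int (\<lfloor>t * snd v\<rfloor> + 1) \<le> r * snd v"
    using less_next_crossing_iff[OF v, of r t] by auto
  then have "\<lfloor>t * fst v\<rfloor> + 1 \<le> \<lfloor>r * fst v\<rfloor> \<or> \<lfloor>t * snd v\<rfloor> + 1 \<le> \<lfloor>r * snd v\<rfloor>"
    unfolding le_floor_iff by blast
  then show ?case using Suc mono unfolding crossing_Suc t_def[symmetric] r_def[symmetric] by auto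
qed (simp add: crossing_0)

lemma crossing_unbounded:
  assumes v: "0 < fst v" "0 < snd v"
  obtains k where "r < crossing v k"
proof -
  obtain k :: nat where k: "r * fst v + r * snd v < real k" using reals_Archimedean2 by blast
  have "r < crossing v k"
  proof (rule ccontr)
    assume "\<not> r < crossing v k"
    then have "crossing v k * fst v \<le> r * fst v" "crossing v k * snd v \<le> r * snd v"
      using v by (simp_all add: mult_right_mono)
    then have "real_of_int (\<lfloor>crossing v k * fst v\<rfloor> + \<lfloor>crossing v k * snd v\<rfloor>) \<le> r * fst v + r * snd v"
      by linarith
    moreover have "real k \<le> real_of_int (\<lfloor>crossing v k * fst v\<rfloor> + \<lfloor>crossing v k * snd v\<rfloor>)"
      using crossing_count[OF v, of k] by linarith
    ultimately show False using k by linarith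
  qed
  then show ?thesis by (rule that)
qed

lemma crossing_interval:
  assumes v: "0 < fst v" "0 < snd v" and "0 \<le> r"
  obtains k where "crossing v k \<le> r" "r < crossing v (Suc k)"
proof -
  obtain m where m: "r < crossing v m" using crossing_unbounded[OF v] .
  have "\<not> r < crossing v 0" using assms(3) by (simp add: crossing_0)
  with m obtain k where "\<not> r < crossing v k" "r < crossing v (Suc k)"
    using ex_least_nat_less[of "\<lambda>k. r < crossing v k" m] by auto
  then show ?thesis by (intro that[of k]) simp_all
qed

text \<open>
  No grid crossing is skipped.
\<close>

lemma crossing_reaches:
  assumes v: "0 < fst v" "0 < snd v" and r: "0 < r" "r * fst v \<in> \<int> \<or> r * snd v \<in> \<int>"
  shows "\<exists>k>0. crossing v k = r"
proof -
  obtain k where k: "crossing v k \<le> r" "r < crossing v (Suc k)"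
    using crossing_interval[OF v less_imp_le[OF r(1)]] .
  have "\<not> crossing v k < r"
    using folded_between_crossings[OF v, of "crossing v k" r] k(2) r(2) by (auto simp: crossing_Suc)
  then have "crossing v k = r" using k(1) by simp
  moreover have "k \<noteq> 0" using calculation r(1) crossing_0[of v] by (metis less_irrefl)
  ultimately show ?thesis by blast
qed

definition folded_line :: "real \<times> real \<Rightarrow> (real \<times> real) set" where
  "folded_line v = (\<lambda>r. fold2 (r *\<^sub>R v)) ` {0..}"

lemma fold2_in_folded_line: "0 \<le> r \<Longrightarrow> fold2 (r *\<^sub>R v) \<in> folded_line v"
  by (simp add: folded_line_def)

lemma segment_folded:
  assumes v: "0 < fst v" "0 < snd v"
  shows "closed_segment (fold2 (t *\<^sub>R v)) (fold2 (next_crossing v t *\<^sub>R v)) =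
    (\<lambda>r. fold2 (r *\<^sub>R v)) ` {t..next_crossing v t}"
proof -
  define d where "d = next_crossing v t - t"
  have d: "0 < d" using next_crossing_gt[OF v] by (simp add: d_def)
  have motion: "fold2 ((t + s) *\<^sub>R v) = fst (folded_state v t) + s *\<^sub>R snd (folded_state v t)"
    if "0 \<le> s" "s \<le> d" for s
    using folded_motion[OF v, of t "t + s"] that by (simp add: d_def)
  have ends: "t + 0 = t" "t + d = next_crossing v t" by (simp_all add: d_def)
  have "(\<lambda>r. fold2 (r *\<^sub>R v)) ` {t..t + d} = (\<lambda>u. fold2 ((t + u * d) *\<^sub>R v)) ` {0..1}"
  proof -
    have "{t..t + d} = (\<lambda>u. t + u * d) ` {0..1}"
    proof (intro equalityI subsetI)
      fix r assume "r \<in> {t..t + d}"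
      then have "r = t + ((r - t) / d) * d" "(r - t) / d \<in> {0..1}" using d by auto
      then show "r \<in> (\<lambda>u. t + u * d) ` {0..1}" by blast
    qed (use d mult_left_le_one_le[of d] in auto)
    then show ?thesis by (simp only: image_image)
  qed
  also have "\<dots> = (\<lambda>u. (1 - u) *\<^sub>R fold2 (t *\<^sub>R v) + u *\<^sub>R fold2 ((t + d) *\<^sub>R v)) ` {0..1}"
  proof (rule image_cong)
    fix u :: real assume u: "u \<in> {0..1}"
    then have "0 \<le> u * d" "u * d \<le> d" using d mult_left_le_one_le[of d u] by auto
    then show "fold2 ((t + u * d) *\<^sub>R v) =
        (1 - u) *\<^sub>R fold2 (t *\<^sub>R v) + u *\<^sub>R fold2 ((t + d) *\<^sub>R v)"
      using motion[of 0] motion[of d] motion[of "u * d"] d by (simp add: algebra_simps)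
  qed simp
  finally show ?thesis by (simp add: closed_segment_image_interval ends)
qed

section \<open>Unobstructed orbits\<close>

lemma folded_state_0: "folded_state (cos \<theta>, sin \<theta>) 0 = initial_state (0, 0) \<theta>"
  by (simp add: folded_state_def initial_state_def fold2_def zigzag_def heading_def)

lemma segment_subset_billiard_path:
  assumes "billiard_orbit a n (initial_state x \<theta>) k = Some S"
  shows "closed_segment (fst S) (hit_point a n S) \<subseteq> billiard_path a n x \<theta>"
  unfolding billiard_path_def using assms by (auto intro!: exI[of _ k])

text \<open>
  The hypothesis \<open>free\<close> involves both the folded line and the billiard path, because two uses are
  made of it.  For the first approximation only the path is known to avoid the obstacle, whereas for
  the later ones only the folded line is.  The induction needs no more than the
  intersection: a segment of the orbit starts on the folded line and follows it up to the first
  contact, and that contact also belongs to the path.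
\<close>

lemma unobstructed_orbit:
  assumes v: "v = (cos \<theta>, sin \<theta>)" "0 < cos \<theta>" "0 < sin \<theta>" and a: "0 < a"
    and free: "folded_line v \<inter> billiard_path a n (0, 0) \<theta> \<inter> obstacles a n = {}"
  shows "billiard_orbit a n (initial_state (0, 0) \<theta>) k = Some (folded_state v (crossing v k))"
    and "hit_point a n (folded_state v (crossing v k)) = fold2 (crossing v (Suc k) *\<^sub>R v)"
proof -
  have pos: "0 < fst v" "0 < snd v" using v by simp_all
  have step: "hit_point a n (folded_state v (crossing v k)) = fold2 (crossing v (Suc k) *\<^sub>R v) \<and>
      billiard_orbit a n (initial_state (0, 0) \<theta>) (Suc k) = Some (folded_state v (crossing v (Suc k)))"
    if orbit: "billiard_orbit a n (initial_state (0, 0) \<theta>) k = Some (folded_state v (crossing v k))"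
    for k
  proof -
    define t where "t = crossing v k"
    have t: "0 \<le> t" using crossing_nonneg[OF pos] by (simp add: t_def)
    have start: "fst (folded_state v t) = fold2 (t *\<^sub>R v)" by (simp add: folded_state_def)
    note segment = segment_subset_billiard_path[OF orbit, folded t_def, unfolded start]
    have "fold2 (t *\<^sub>R v) \<notin> obstacles a n"
      using segment fold2_in_folded_line[OF t, of v] free by auto
    then obtain m where m: "t < m" "hit_point a n (folded_state v t) = fold2 (m *\<^sub>R v)"
      "m = next_crossing v t \<or> fold2 (m *\<^sub>R v) \<in> obstacles a n"
      using first_contact[OF pos] by metis
    have "fold2 (m *\<^sub>R v) \<in> billiard_path a n (0, 0) \<theta>" using segment m(2) by auto
    moreover have "fold2 (m *\<^sub>R v) \<in> folded_line v" using t m(1) by (simp add: fold2_in_folded_line)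
    ultimately have "fold2 (m *\<^sub>R v) \<notin> obstacles a n" using free by blast
    then show ?thesis
      using m orbit step_folded_state[OF pos a, of n t]
      by (auto simp: crossing_Suc t_def)
  qed
  show orbit: "billiard_orbit a n (initial_state (0, 0) \<theta>) k = Some (folded_state v (crossing v k))" for k
  proof (induction k)
    case 0
    then show ?case by (simp add: crossing_0 v(1) folded_state_0)
  next
    case (Suc k)
    then show ?case using step by blast
  qed
  show "hit_point a n (folded_state v (crossing v k)) = fold2 (crossing v (Suc k) *\<^sub>R v)"
    using step orbit by blast
qed

lemma folded_line_segments:
  assumes v: "0 < fst v" "0 < snd v"
  shows "folded_line v =
    (\<Union>k. closed_segment (fold2 (crossing v k *\<^sub>R v)) (fold2 (crossing v (Suc k) *\<^sub>R v)))"
proof -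
  have "{0..} = (\<Union>k. {crossing v k..crossing v (Suc k)})"
  proof (intro equalityI subsetI)
    fix r :: real assume "r \<in> {0..}"
    then obtain k where "crossing v k \<le> r" "r < crossing v (Suc k)"
      using crossing_interval[OF v, of r] by auto
    then have "r \<in> {crossing v k..crossing v (Suc k)}" by simp
    then show "r \<in> (\<Union>k. {crossing v k..crossing v (Suc k)})" by blast
  next
    fix r assume "r \<in> (\<Union>k. {crossing v k..crossing v (Suc k)})"
    then obtain k where "crossing v k \<le> r" by auto
    then show "r \<in> {0..}" using crossing_nonneg[OF v, of k] by simp
  qed
  then show ?thesis
    by (simp add: folded_line_def crossing_Suc segment_folded[OF v] image_UN)
qed

lemma unobstructed_path:
  assumes v: "v = (cos \<theta>, sin \<theta>)" "0 < cos \<theta>" "0 < sin \<theta>" and a: "0 < a"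
    and free: "folded_line v \<inter> billiard_path a n (0, 0) \<theta> \<inter> obstacles a n = {}"
  shows "billiard_path a n (0, 0) \<theta> = folded_line v"
proof -
  have "fst (folded_state v t) = fold2 (t *\<^sub>R v)" for t by (simp add: folded_state_def)
  then show ?thesis
    using v unobstructed_orbit[OF assms]
    by (simp add: billiard_path_def folded_line_segments)
qed

text \<open>
  If \<open>tan \<theta> = m / n\<close>, the unfolded line meets the point \<open>(2 * n, 2 * m)\<close>.  Its coordinates are even,
  so the folded state there is the initial one; odd ones would lead to another corner.
\<close>

lemma folded_line_periodic:
  assumes v: "v = (cos \<theta>, sin \<theta>)" "0 < cos \<theta>" "0 < sin \<theta>" and rat: "tan \<theta> \<in> \<rat>"
  shows "\<exists>k>0. folded_state v (crossing v k) = initial_state (0, 0) \<theta>"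
proof -
  obtain m n :: nat where mn: "n \<noteq> 0" "\<bar>tan \<theta>\<bar> = real m / real n"
    using Rats_abs_nat_div_natE[OF rat] .
  have "0 < tan \<theta>" using v by (simp add: tan_def)
  then have slope: "sin \<theta> / cos \<theta> = real m / real n" using mn(2) v by (simp add: tan_def)
  \<comment> \<open>The time at which the line reaches \<open>(2 * n, 2 * m)\<close>.\<close>
  define P where "P = 2 * real n / cos \<theta>"
  have P: "0 < P" "P * fst v = of_int (2 * int n)" using v mn(1) by (simp_all add: P_def)
  have "P * snd v = 2 * real n * (sin \<theta> / cos \<theta>)" by (simp add: P_def v(1))
  then have P2: "P * snd v = of_int (2 * int m)" using mn(1) by (simp add: slope)
  have "P * fst v \<in> \<int>" by (simp only: P Ints_of_int)
  then obtain k where k: "k > 0" "crossing v k = P"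
    using crossing_reaches[of v P] v P(1) by auto
  have even_int: "zigzag (of_int (2 * i)) = 0" "heading (of_int (2 * i)) = 1" for i
    by (simp_all only: zigzag_def heading_def floor_of_int) simp_all
  have "folded_state v P = initial_state (0, 0) \<theta>"
    by (simp only: folded_state_def fold2_def fst_scaleR snd_scaleR real_scaleR_def P P2 even_int)
      (simp add: initial_state_def v(1))
  then show ?thesis using k by blast
qed

section \<open>Avoiding one square is avoiding all of them\<close>

lemma approx_carpet_eq:
  "approx_carpet a n = closed_square unit_square - (\<Union>Q\<in>removed a n. open_square Q)"
  by (induction n) (auto simp: removed_def lessThan_Suc)

lemma middle_in_open_unit_square:
  assumes "odd a" "a \<ge> 3"
  shows "closed_square (middle a unit_square) \<subseteq> open_square unit_square"
proof
  fix z assume "z \<in> closed_square (middle a unit_square)"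
  then have "\<bar>fst z - 1 / 2\<bar> \<le> 1 / (2 * real a)" "\<bar>snd z - 1 / 2\<bar> \<le> 1 / (2 * real a)"
    by (simp_all add: mem_middle_unit_square[OF assms(1)])
  moreover have "1 / (2 * real a) < 1 / 2" using assms(2) by simp
  ultimately show "z \<in> open_square unit_square"
    by (simp add: unit_square_def mem_open_square abs_le_iff; linarith)
qed

text \<open>
  To get inside the middle square the folded line would have to cross its boundary.  Each segment of
  it is connected and starts on the boundary of the unit square, hence outside the middle square.
\<close>

lemma avoids_middle_closed:
  assumes v: "0 < fst v" "0 < snd v" and a: "odd a" "a \<ge> 3"
    and avoid: "folded_line v \<inter> peripheral_square (middle a unit_square) = {}"
  shows "folded_line v \<inter> closed_square (middle a unit_square) = {}"
proof -
  let ?M = "middle a unit_square"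
  have sub: "closed_square ?M \<subseteq> open_square unit_square"
    by (rule middle_in_open_unit_square[OF a])
  have "closed_segment (fold2 (crossing v k *\<^sub>R v)) (fold2 (crossing v (Suc k) *\<^sub>R v)) \<inter> open_square ?M = {}"
    (is "?I \<inter> _ = {}") for k
  proof (rule ccontr)
    assume "?I \<inter> open_square ?M \<noteq> {}"
    moreover have "fold2 (crossing v k *\<^sub>R v) \<in> ?I - open_square ?M"
    proof -
      have "fold2 (crossing v k *\<^sub>R v) \<in> frontier (closed_square unit_square)"
        using crossing_Ints[OF v, of k] by (simp add: fold2_wall_iff)
      then show ?thesis
        using sub open_square_subset_closed_square[of ?M] by (auto simp: frontier_closed_square)
    qed
    ultimately have "?I \<inter> frontier (open_square ?M) \<noteq> {}"
      using connected_Int_frontier[of ?I "open_square ?M"] by blast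
    moreover have "?I \<subseteq> folded_line v" unfolding folded_line_segments[OF v] by blast
    ultimately show False using avoid by (auto simp: peripheral_square_def)
  qed
  then have "folded_line v \<inter> open_square ?M = {}"
    unfolding folded_line_segments[OF v] by blast
  moreover have "closed_square ?M \<subseteq> open_square ?M \<union> peripheral_square ?M"
    using a by (subst peripheral_square_eq) (auto simp: middle_def unit_square_def)
  ultimately show ?thesis using avoid by blast
qed

text \<open>
  A common point at time \<open>r\<close> would yield a point of the middle square at time \<open>a ^ k * r\<close>.
\<close>

lemma avoids_all_removed:
  assumes "odd a" "folded_line v \<inter> closed_square (middle a unit_square) = {}"
    and Q: "Q \<in> removed a n"
  shows "folded_line v \<inter> closed_square Q = {}"
proof (rule ccontr)
  assume "folded_line v \<inter> closed_square Q \<noteq> {}"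
  then obtain r where r: "0 \<le> r" "fold2 (r *\<^sub>R v) \<in> closed_square Q"
    by (auto simp: folded_line_def)
  obtain k R where R: "R \<in> remaining a k" "Q = middle a R" using Q by (auto simp: removed_def)
  have "fold2 (real (a ^ k) *\<^sub>R fold2 (r *\<^sub>R v)) \<in> closed_square (middle a unit_square)"
    using removed_magnified[OF assms(1) R(1)] r(2) R(2) by blast
  then have "fold2 ((real (a ^ k) * r) *\<^sub>R v) \<in> closed_square (middle a unit_square)"
    by (simp only: fold2_scale_fold2 scaleR_scaleR)
  moreover have "fold2 ((real (a ^ k) * r) *\<^sub>R v) \<in> folded_line v"
    using r(1) by (intro fold2_in_folded_line) simp
  ultimately show False using assms(2) by blast
qed

lemma avoids_obstacles:
  assumes "odd a" "folded_line v \<inter> closed_square (middle a unit_square) = {}"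
  shows "folded_line v \<inter> obstacles a n = {}"
proof -
  have "0 < a" using assms(1) by (rule odd_pos)
  have "peripheral_square Q \<subseteq> closed_square Q" if "Q \<in> removed a n" for Q
    using peripheral_square_eq[OF side_removed_pos[OF \<open>0 < a\<close> that]] by blast
  then show ?thesis
    using avoids_all_removed[OF assms, of _ n] by (fastforce simp: obstacles_def)
qed

text \<open>
  Up to the first crossing the line is not folded at all, so it runs in the open unit square and
  avoids the finitely many closed removed squares.
\<close>

lemma initial_condition_origin:
  assumes v: "v = (cos \<theta>, sin \<theta>)" "0 < cos \<theta>" "0 < sin \<theta>"
    and free: "\<And>Q. Q \<in> removed a n \<Longrightarrow> folded_line v \<inter> closed_square Q = {}"
  shows "initial_condition a n (0, 0) \<theta>"
proof -
  have pos: "0 < fst v" "0 < snd v" using v by simp_all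
  define U where "U = open_square unit_square - (\<Union>Q\<in>removed a n. closed_square Q)"
  have "open U"
    unfolding U_def
    by (intro open_Diff closed_UN finite_removed ballI closed_closed_square)
      (simp add: open_square_def unit_square_def open_box)
  moreover have "U \<subseteq> approx_carpet a n"
    unfolding U_def approx_carpet_eq
    using open_square_subset_closed_square by (intro Diff_mono UN_mono) auto
  ultimately have U: "U \<subseteq> interior (approx_carpet a n)" by (simp add: interior_maximal)
  have "t *\<^sub>R v \<in> U" if t: "0 < t" "t < next_crossing v 0" for t
  proof -
    have "t * fst v < 1" "t * snd v < 1"
      using t(2) less_next_crossing_iff[OF pos, of t 0] by simp_all
    moreover have "0 < t * fst v" "0 < t * snd v" using t(1) pos by simp_all
    ultimately have "t *\<^sub>R v \<in> open_square unit_square" "fold2 (t *\<^sub>R v) = t *\<^sub>R v"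
      using zigzag_between[of 0 "t * fst v"] zigzag_between[of 0 "t * snd v"]
      by (simp_all add: unit_square_def mem_open_square fold2_def prod_eq_iff)
    moreover have "fold2 (t *\<^sub>R v) \<in> folded_line v" using t(1) by (simp add: fold2_in_folded_line)
    ultimately show ?thesis using free by (auto simp: U_def)
  qed
  then have "\<forall>t\<in>{0<..<next_crossing v 0}. (0, 0) + t *\<^sub>R (cos \<theta>, sin \<theta>) \<in> interior (approx_carpet a n)"
    using U by (auto simp: v(1))
  moreover have "0 < next_crossing v 0" using next_crossing_gt[OF pos] .
  moreover have "(0, 0) \<in> walls a n"
    by (simp add: walls_eq frontier_closed_square unit_square_def mem_closed_square mem_open_square)
  ultimately show ?thesis unfolding initial_condition_def by blast
qed

lemma initial_condition_direction:
  assumes "initial_condition a 0 (0, 0) \<theta>"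
  shows "0 < cos \<theta>" "0 < sin \<theta>"
proof -
  obtain e where e: "e > 0"
    "\<forall>t\<in>{0<..<e}. (0, 0) + t *\<^sub>R (cos \<theta>, sin \<theta>) \<in> open_square unit_square"
    using assms by (auto simp: initial_condition_def interior_closed_square)
  moreover have "e / 2 \<in> {0<..<e}" using e(1) by simp
  ultimately have "(0, 0) + (e / 2) *\<^sub>R (cos \<theta>, sin \<theta>) \<in> open_square unit_square" by blast
  then show "0 < cos \<theta>" "0 < sin \<theta>"
    using e(1) by (simp_all add: unit_square_def mem_open_square zero_less_mult_iff)
qed

lemma carpet_path_eq:
  assumes "carpet_orbit a x \<theta> P"
  shows "carpet_path a x \<theta> = P"
  unfolding carpet_path_def
proof (rule the_equality)
  fix P' assume "carpet_orbit a x \<theta> P'"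
  with assms obtain N N' where "\<forall>n\<ge>N. billiard_path a n x \<theta> = P" "\<forall>n\<ge>N'. billiard_path a n x \<theta> = P'"
    unfolding carpet_orbit_def by blast
  then show "P' = P" by (metis max.cobounded1 max.cobounded2)
qed (rule assms)

theorem theorem5p11:
  fixes a :: nat and \<alpha> \<theta> :: real
  assumes "a \<ge> 3" and "odd a"
    and "\<alpha> \<in> \<rat>" and "\<alpha> = tan \<theta>"
    and "initial_condition a 0 (0, 0) \<theta>"
    and "billiard_path a 1 (0, 0) \<theta> \<inter> peripheral_square (middle a unit_square) = {}"
  shows "determines_carpet_orbit a (0, 0) \<theta> \<and>
         billiard_path a 1 (0, 0) \<theta> = carpet_path a (0, 0) \<theta>"
proof -
  define v where "v = (cos \<theta>, sin \<theta>)"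
  have cs: "0 < cos \<theta>" "0 < sin \<theta>" using initial_condition_direction[OF assms(5)] .
  have v: "0 < fst v" "0 < snd v" using cs by (simp_all add: v_def)
  have a: "0 < a" using assms(1) by simp
  have "obstacles a 1 = peripheral_square (middle a unit_square)"
    unfolding obstacles_def removed_1 by simp
  then have path_1: "billiard_path a 1 (0, 0) \<theta> = folded_line v"
    using assms(6) by (intro unobstructed_path[OF v_def cs a]) blast
  have avoid: "folded_line v \<inter> closed_square (middle a unit_square) = {}"
    using avoids_middle_closed[OF v assms(2,1)] assms(6) path_1 by simp
  have "initial_condition a n (0, 0) \<theta> \<and> periodic_orbit a n (0, 0) \<theta> \<and>
      billiard_path a n (0, 0) \<theta> = folded_line v" for n
  proof -
    have free: "folded_line v \<inter> billiard_path a n (0, 0) \<theta> \<inter> obstacles a n = {}"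
      using avoids_obstacles[OF assms(2) avoid] by blast
    have "periodic_orbit a n (0, 0) \<theta>"
      using folded_line_periodic[OF v_def cs] assms(3,4) unobstructed_orbit(1)[OF v_def cs a free]
      by (auto simp: periodic_orbit_def)
    moreover have "initial_condition a n (0, 0) \<theta>"
      using avoids_all_removed[OF assms(2) avoid] by (rule initial_condition_origin[OF v_def cs])
    ultimately show ?thesis using unobstructed_path[OF v_def cs a free] by blast
  qed
  then have "carpet_orbit a (0, 0) \<theta> (folded_line v)" by (simp add: carpet_orbit_def)
  then show ?thesis
    using carpet_path_eq path_1 by (auto simp: determines_carpet_orbit_def)
qed

end
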